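(* Let $\Omega\subset\mathbb{R}^N$ be a bounded smooth domain, $p>1$, $r,s\in(0,1)$, and let $\alpha,\beta\in(0,p)$ satisfy $\alpha+\beta=p$ and $\min\{\alpha,\beta\}\ge 1$. If $(u,v)$ is an eigenpair corresponding to $\lambda_{1,p}$, then $u,v\in L^\infty(\mathbb{R}^N)$.
   Context: For $t\in(0,1)$ and $p>1$, $W^{t,p}(\Omega)=\{w\in L^p(\Omega)\colon \int_{\Omega\times\Omega}\frac{|w(x)-w(y)|^p}{|x-y|^{N+tp}}\,dx\,dy<\infty\}$, and $\widetilde W^{t,p}(\Omega)$ is the space of all $w\in W^{t,p}(\Omega)$ whose extension by zero outside $\Omega$ belongs to $W^{t,p}(\mathbb{R}^N)$; its elements are identified with their extensions by zero. Put $[w]_{t,p}^p=\int_{\mathbb{R}^{2N}}\frac{|w(x)-w(y)|^p}{|x-y|^{N+tp}}\,dx\,dy$ and $$\lambda_{1,p}=\inf\left\{\frac{[u]_{r,p}^p+[v]_{s,p}^p}{\int_\Omega |u|^\alpha|v|^\beta\,dx}\colon (u,v)\in\widetilde W^{r,p}(\Omega)\times\widetilde W^{s,p}(\Omega),\ uv\not\equiv 0\right\}.$$ An eigenpair corresponding to $\lambda\in\mathbb{R}$ is a pair $(u,v)\in\widetilde W^{r,p}(\Omega)\times\widetilde W^{s,p}(\Omega)$ with $uv\not\equiv0$ (not a.e. zero) such that for all $(w,z)\in\widetilde W^{r,p}(\Omega)\times\widetilde W^{s,p}(\Omega)$, $$\int_{\mathbb{R}^{2N}}\frac{|u(x)-u(y)|^{p-2}(u(x)-u(y))(w(x)-w(y))}{|x-y|^{N+rp}}\,dx\,dy=\lambda\frac{\alpha}{p}\int_\Omega|u|^{\alpha-2}u|v|^\beta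 w\,dx,$$ $$\int_{\mathbb{R}^{2N}}\frac{|v(x)-v(y)|^{p-2}(v(x)-v(y))(z(x)-z(y))}{|x-y|^{N+sp}}\,dx\,dy=\lambda\frac{\beta}{p}\int_\Omega|u|^{\alpha}|v|^{\beta-2}v z\,dx,$$ where $|\tau|^{q-2}\tau$ is understood to be $0$ at $\tau=0$. *)

theory Defs
  imports "HOL-Analysis.Analysis"
begin

primrec C_k :: "nat \<Rightarrow> ('a::euclidean_space \<Rightarrow> real) \<Rightarrow> bool" where
  "C_k 0 f \<longleftrightarrow> continuous_on UNIV f"
| "C_k (Suc k) f \<longleftrightarrow>
     (\<exists>f'. (\<forall>x. (f has_derivative f' x) (at x)) \<and> (\<forall>h. C_k k (\<lambda>x. f' x h)))"

definition smooth :: "('a::euclidean_space \<Rightarrow> real) \<Rightarrow> bool" where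
  "smooth f \<longleftrightarrow> (\<forall>k. C_k k f)"

text \<open>
  Near every boundary point, the domain lies strictly above the graph of a smooth function
  over the hyperplane orthogonal to a unit vector \<open>e\<close>. The function \<open>\<gamma>\<close> of the \<open>N - 1\<close>
  remaining coordinates is encoded as a function on the whole space that is constant in the
  direction \<open>e\<close>; for \<open>N = 1\<close> it is a constant.
\<close>

definition smooth_boundary :: "'a::euclidean_space set \<Rightarrow> bool" where
  "smooth_boundary \<Omega> \<longleftrightarrow>
     (\<forall>x0\<in>frontier \<Omega>. \<exists>\<rho>>0. \<exists>e \<gamma>. norm e = 1 \<and> smooth \<gamma> \<and>
        (\<forall>x t. \<gamma> (x + t *\<^sub>R e) = \<gamma> x) \<and>
        \<Omega> \<inter> ball x0 \<rho> = {x \<in> ball x0 \<rho>. x \<bullet> e > \<gamma> x})"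

definition bounded_smooth_domain :: "'a::euclidean_space set \<Rightarrow> bool" where
  "bounded_smooth_domain \<Omega> \<longleftrightarrow>
     open \<Omega> \<and> connected \<Omega> \<and> \<Omega> \<noteq> {} \<and> bounded \<Omega> \<and> smooth_boundary \<Omega>"

definition gagliardo_density ::
    "real \<Rightarrow> real \<Rightarrow> ('a::euclidean_space \<Rightarrow> real) \<Rightarrow> 'a \<times> 'a \<Rightarrow> real" where
  "gagliardo_density t p w =
     (\<lambda>(x, y). \<bar>w x - w y\<bar> powr p / norm (x - y) powr (real DIM('a) + t * p))"

text \<open>
  Functions stand for their classes modulo equality almost everywhere. The double integral
  over \<open>\<Omega> \<times> \<Omega>\<close> is taken with respect to Lebesgue measure on the product space.
\<close>

definition frac_sobolev :: "real \<Rightarrow> real \<Rightarrow> 'a::euclidean_space set \<Rightarrow> ('a \<Rightarrow> real) set" where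
  "frac_sobolev t p \<Omega> =
     {w. w \<in> borel_measurable (lebesgue_on \<Omega>) \<and>
         integrable (lebesgue_on \<Omega>) (\<lambda>x. \<bar>w x\<bar> powr p) \<and>
         integrable (lebesgue_on (\<Omega> \<times> \<Omega>)) (gagliardo_density t p w)}"

text \<open>
  The elements are identified with their extensions by zero, so the representatives are
  functions on the whole space that vanish outside \<open>\<Omega>\<close>.
\<close>

definition frac_sobolev_zero ::
    "real \<Rightarrow> real \<Rightarrow> 'a::euclidean_space set \<Rightarrow> ('a \<Rightarrow> real) set" where
  "frac_sobolev_zero t p \<Omega> =
     {w. w \<in> frac_sobolev t p \<Omega> \<and> w \<in> frac_sobolev t p UNIV \<and> (\<forall>x. x \<notin> \<Omega> \<longrightarrow> w x = 0)}"

definition gagliardo_pow :: "real \<Rightarrow> real \<Rightarrow> ('a::euclidean_space \<Rightarrow> real) \<Rightarrow> real" where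
  "gagliardo_pow t p w = (LINT z|lebesgue. gagliardo_density t p w z)"

definition lambda1 ::
    "'a::euclidean_space set \<Rightarrow> real \<Rightarrow> real \<Rightarrow> real \<Rightarrow> real \<Rightarrow> real \<Rightarrow> real" where
  "lambda1 \<Omega> p r s \<alpha> \<beta> =
     Inf {(gagliardo_pow r p u + gagliardo_pow s p v)
            / (LINT x|lebesgue_on \<Omega>. \<bar>u x\<bar> powr \<alpha> * \<bar>v x\<bar> powr \<beta>) | u v.
          u \<in> frac_sobolev_zero r p \<Omega> \<and> v \<in> frac_sobolev_zero s p \<Omega> \<and>
          \<not> (AE x in lebesgue_on \<Omega>. u x * v x = 0)}"

text \<open>
  The left-hand side of the weak equations. The factor \<open>\<bar>\<tau>\<bar> powr (q - 2) * \<tau>\<close>, here and below,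
  is \<open>0\<close> at \<open>\<tau> = 0\<close> for every \<open>q\<close>.
\<close>

definition frac_plap_form ::
    "real \<Rightarrow> real \<Rightarrow> ('a::euclidean_space \<Rightarrow> real) \<Rightarrow> ('a \<Rightarrow> real) \<Rightarrow> real" where
  "frac_plap_form t p u w =
     (LINT (x, y)|lebesgue. \<bar>u x - u y\<bar> powr (p - 2) * (u x - u y) * (w x - w y)
        / norm (x - y) powr (real DIM('a) + t * p))"

definition eigenpair ::
    "'a::euclidean_space set \<Rightarrow> real \<Rightarrow> real \<Rightarrow> real \<Rightarrow> real \<Rightarrow> real \<Rightarrow> real \<Rightarrow>
     ('a \<Rightarrow> real) \<Rightarrow> ('a \<Rightarrow> real) \<Rightarrow> bool" where
  "eigenpair \<Omega> p r s \<alpha> \<beta> \<mu> u v \<longleftrightarrow>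
     u \<in> frac_sobolev_zero r p \<Omega> \<and> v \<in> frac_sobolev_zero s p \<Omega> \<and>
     \<not> (AE x in lebesgue_on \<Omega>. u x * v x = 0) \<and>
     (\<forall>w\<in>frac_sobolev_zero r p \<Omega>. \<forall>z\<in>frac_sobolev_zero s p \<Omega>.
        frac_plap_form r p u w =
          \<mu> * (\<alpha> / p) * (LINT x|lebesgue_on \<Omega>.
             \<bar>u x\<bar> powr (\<alpha> - 2) * u x * \<bar>v x\<bar> powr \<beta> * w x) \<and>
        frac_plap_form s p v z =
          \<mu> * (\<beta> / p) * (LINT x|lebesgue_on \<Omega>.
             \<bar>u x\<bar> powr \<alpha> * \<bar>v x\<bar> powr (\<beta> - 2) * v x * z x))"

definition L_infinity :: "('a::euclidean_space \<Rightarrow> real) set" where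
  "L_infinity = {w. w \<in> borel_measurable lebesgue \<and> (\<exists>C. AE x in lebesgue. \<bar>w x\<bar> \<le> C)}"

end

theory Submission
  imports Defs
begin

text \<open>
  The proof is De Giorgi's truncation method. The coupling of the two equations disappears
  because both are tested at the same level and controlled by the one function
  \<open>m = max \<bar>u\<bar> \<bar>v\<bar>\<close>.

  Write \<open>S\<^sub>k\<close> for the soft threshold that moves a number towards \<open>0\<close> by \<open>k\<close>, and put
  \<open>m\<^sub>k = max 0 (m - k)\<close>, \<open>A\<^sub>k = {m > k}\<close>. As \<open>S\<^sub>k\<close> is monotone and 1-Lipschitz, \<open>S\<^sub>k u\<close> and
  \<open>S\<^sub>k v\<close> are admissible test functions, and the Gagliardo energy of \<open>S\<^sub>k u\<close> is at most the
  left-hand side of the equation of \<open>u\<close> tested with it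
  (\<open>gagliardo_pow_soft_threshold_le\<close>). Since \<open>\<alpha>, \<beta> \<ge> 1\<close> and \<open>\<alpha> + \<beta> = p\<close>, both right-hand sides
  are at most a constant times \<open>\<integral> m\<^sup>p\<^sup>-\<^sup>1 m\<^sub>k\<close> (\<open>source_term_bound\<close>).

  The gain comes from a fractional Faber-Krahn inequality (\<open>fractional_faber_krahn\<close>): a function
  \<open>w\<close> supported in a set \<open>A\<close> satisfies \<open>\<integral> \<bar>w\<bar>\<^sup>p \<le> C \<bar>A\<bar>\<^bsup>tp/N\<^esup> [w]\<^sup>p\<close>. Unlike the Sobolev
  inequality it is elementary, because a ball twice as large as \<open>A\<close> around any point of \<open>A\<close> has
  at least half of its volume outside \<open>A\<close>, where \<open>w\<close> vanishes. Together these facts give, with some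
  \<open>\<delta> > 0\<close> and for all large \<open>k\<close>,
  \<open>\<integral> m\<^sub>k\<^sup>p \<le> C \<bar>A\<^sub>k\<bar>\<^sup>\<delta> \<integral> m\<^sup>p\<^sup>-\<^sup>1 m\<^sub>k\<close>.

  From here on only measure theory is needed (\<open>bounded_of_caccioppoli\<close>). For large \<open>k\<close> the set
  \<open>A\<^sub>k\<close> is small, part of the right-hand side is absorbed, and Young's inequality yields
  \<open>\<integral> m\<^sub>k \<le> C k \<bar>A\<^sub>k\<bar>\<^bsup>1+\<epsilon>\<^esup>\<close>. Iterating this along the levels \<open>K (2 - 2\<^sup>-\<^sup>n)\<close> shows that \<open>m\<close> is at
  most \<open>2 K\<close> almost everywhere when \<open>K\<close> is large.
\<close>

section \<open>De Giorgi iteration\<close>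

text \<open>
  The superlinear power \<open>1 + \<epsilon>\<close> beats the geometrically growing factor \<open>b ^ n\<close> if the sequence
  starts small enough. The rate \<open>\<eta> = b powr (- 1 / \<epsilon>)\<close> is the one for which
  \<open>(\<eta> ^ n) powr \<epsilon>\<close> cancels \<open>b ^ n\<close> exactly.
\<close>

lemma superlinear_recursion_decay:
  fixes g :: "nat \<Rightarrow> real" and B b \<epsilon> :: real
  assumes "0 \<le> B" and "1 < b" and "0 < \<epsilon>" and nonneg: "\<And>n. 0 \<le> g n"
    and rec: "\<And>n. g (Suc n) \<le> B * b ^ Suc n * g n powr (1 + \<epsilon>)"
    and small: "B * b * b powr (1 / \<epsilon>) * g 0 powr \<epsilon> \<le> 1"
  shows "g n \<le> g 0 * (b powr (- 1 / \<epsilon>)) ^ n"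
proof (induction n)
  case 0
  then show ?case by simp
next
  case (Suc n)
  define \<eta> where "\<eta> = b powr (- 1 / \<epsilon>)"
  have \<eta>: "\<eta> > 0" and b: "b > 0" using assms by (auto simp: \<eta>_def)
  have inv: "b powr (1 / \<epsilon>) * \<eta> = 1"
    using b by (simp add: \<eta>_def powr_minus)
  have "(\<eta> ^ n) powr \<epsilon> = b powr (- real n)"
    using b \<open>0 < \<epsilon>\<close> by (simp add: \<eta>_def powr_powr flip: powr_realpow)
  also have "\<dots> = 1 / b ^ n"
    using b by (simp add: powr_minus powr_realpow divide_inverse)
  finally have pow: "(\<eta> ^ n) powr \<epsilon> = 1 / b ^ n" .
  have split: "y powr (1 + \<epsilon>) = y * y powr \<epsilon>" if "y \<ge> 0" for y
    using that by (simp add: powr_add)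
  have "g (Suc n) \<le> B * b ^ Suc n * g n powr (1 + \<epsilon>)" by (rule rec)
  also have "\<dots> \<le> B * b ^ Suc n * (g 0 * \<eta> ^ n) powr (1 + \<epsilon>)"
    using Suc nonneg[of n] assms by (intro mult_left_mono powr_mono2) (auto simp: \<eta>_def)
  also have "\<dots> = B * b ^ Suc n * (g 0 * \<eta> ^ n) * (g 0 powr \<epsilon> * (\<eta> ^ n) powr \<epsilon>)"
    using nonneg[of 0] \<eta> by (simp add: split powr_mult)
  also have "\<dots> = B * b * g 0 powr \<epsilon> * (b powr (1 / \<epsilon>) * \<eta>) * (g 0 * \<eta> ^ n)"
    using b unfolding pow inv by (simp add: field_simps)
  also have "\<dots> = (B * b * b powr (1 / \<epsilon>) * g 0 powr \<epsilon>) * (g 0 * \<eta> ^ Suc n)"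
    by simp
  also have "\<dots> \<le> 1 * (g 0 * \<eta> ^ Suc n)"
    using small nonneg[of 0] \<eta> by (intro mult_right_mono) auto
  finally show ?case by (simp add: \<eta>_def)
qed

context
  fixes M :: "'b measure" and m :: "'b \<Rightarrow> real" and p :: real
  assumes meas [measurable]: "m \<in> borel_measurable M"
    and nonneg: "\<And>x. 0 \<le> m x"
    and p: "1 < p"
    and int_p: "integrable M (\<lambda>x. m x powr p)"
begin

lemma excess_le_powr:
  assumes "0 < k"
  shows "max 0 (m x - k) \<le> m x powr p / k powr (p - 1)"
proof (cases "m x \<le> k")
  case True
  then show ?thesis by simp
next
  case False
  then have pos: "m x > 0" using assms by linarith
  have "m x * k powr (p - 1) \<le> m x * m x powr (p - 1)"
    using False assms p pos by (intro mult_left_mono powr_mono2) auto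
  also have "\<dots> = m x powr p" using pos by (simp add: powr_mult_base)
  finally show ?thesis
    using False assms pos by (simp add: field_simps) (smt (verit) powr_ge_zero mult_nonneg_nonneg)
qed

lemma integrable_excess:
  assumes "0 < k"
  shows "integrable M (\<lambda>x. max 0 (m x - k))"
  by (rule Bochner_Integration.integrable_bound[where f="\<lambda>x. m x powr p / k powr (p - 1)"])
     (use assms int_p excess_le_powr in auto)

lemma integral_excess_antimono:
  assumes "0 < k" and "k \<le> l"
  shows "(LINT x|M. max 0 (m x - l)) \<le> (LINT x|M. max 0 (m x - k))"
  using assms by (intro integral_mono integrable_excess) auto

lemma superlevel_Int_space: "{x \<in> space M. k < m x} \<inter> space M = {x \<in> space M. k < m x}"
  by blast

lemma measure_superlevel_le:
  assumes "0 < k" and "k < l"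
  shows "measure M {x \<in> space M. l < m x} \<le> (LINT x|M. max 0 (m x - k)) / (l - k)"
proof -
  have "(LINT x|M. (l - k) * indicator {x \<in> space M. l < m x} x) \<le> (LINT x|M. max 0 (m x - k))"
    using assms by (intro integral_mono' integrable_excess) (auto simp: indicator_def)
  then have "(l - k) * measure M {x \<in> space M. l < m x} \<le> (LINT x|M. max 0 (m x - k))"
    by (simp only: integral_mult_right_zero Bochner_Integration.integral_indicator superlevel_Int_space)
  then show ?thesis
    using assms by (simp add: pos_le_divide_eq mult.commute)
qed

lemma indicator_superlevel_le:
  assumes "0 < k"
  shows "indicator {x \<in> space M. k < m x} x \<le> m x powr p / k powr p"
  using assms p by (auto simp: indicator_def intro!: powr_mono2)

lemma finite_superlevel:
  assumes "0 < k"
  shows "emeasure M {x \<in> space M. k < m x} < \<infinity>"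
proof -
  have "integrable M (\<lambda>x. indicator {x \<in> space M. k < m x} x :: real)"
    by (rule Bochner_Integration.integrable_bound[where f="\<lambda>x. m x powr p / k powr p"])
       (use int_p indicator_superlevel_le[OF assms] in auto)
  then show ?thesis
    by (simp add: integrable_indicator_iff superlevel_Int_space less_top[symmetric])
qed

lemma measure_superlevel_le_powr:
  assumes "0 < k"
  shows "measure M {x \<in> space M. k < m x} \<le> (LINT x|M. m x powr p) / k powr p"
proof -
  have "(LINT x|M. indicator {x \<in> space M. k < m x} x) \<le> (LINT x|M. m x powr p / k powr p)"
    using int_p indicator_superlevel_le[OF assms] by (intro integral_mono') auto
  then show ?thesis by (simp add: superlevel_Int_space)
qed

lemma integral_excess_le:
  assumes "0 < k"
  shows "(LINT x|M. max 0 (m x - k)) \<le> (LINT x|M. m x powr p) / k powr (p - 1)"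
proof -
  have "(LINT x|M. max 0 (m x - k)) \<le> (LINT x|M. m x powr p / k powr (p - 1))"
    using assms int_p by (intro integral_mono' excess_le_powr) auto
  then show ?thesis by simp
qed

text \<open>
  Chebyshev's inequality bounds the measure of a superlevel set by the excess over a lower level,
  so the hypothesis turns into a superlinear recursion for the excesses over the levels
  \<open>K * (2 - 1 / 2 ^ n)\<close>, which increase to \<open>2 * K\<close>. The factor \<open>k\<close> on the right is harmless
  because the excesses are divided by \<open>K\<close>; the initial one is then at most the integral of
  \<open>m powr p\<close> over \<open>K powr p\<close>, which is small for large \<open>K\<close>.
\<close>

lemma bounded_of_superlevel_decay:
  assumes "0 \<le> C" and "0 < \<epsilon>" and "0 < k0"
    and decay: "\<And>k. k \<ge> k0 \<Longrightarrow> (LINT x|M. max 0 (m x - k))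
       \<le> C * k * measure M {x \<in> space M. k < m x} powr (1 + \<epsilon>)"
  shows "\<exists>K. AE x in M. m x \<le> K"
proof -
  define F where "F k = (LINT x|M. max 0 (m x - k))" for k
  define I where "I = (LINT x|M. m x powr p)"
  define b where "b = (2::real) powr (1 + \<epsilon>)"
  define Q where "Q = 2 * C * b * b powr (1 / \<epsilon>)"
  define t where "t = (1 / (Q + 1)) powr (1 / \<epsilon>)"
  define K where "K = max (max k0 1) (I / t)"
  define g where "g n = F (K * (2 - 1 / 2 ^ n)) / K" for n :: nat
  have F0: "F k \<ge> 0" for k unfolding F_def by (rule Bochner_Integration.integral_nonneg) auto
  have I0: "I \<ge> 0" unfolding I_def by (rule Bochner_Integration.integral_nonneg) auto
  have b1: "b > 1" unfolding b_def using assms by (intro gr_one_powr) auto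
  have Q0: "Q \<ge> 0" using assms b1 by (auto simp: Q_def)
  have t0: "t > 0" using Q0 by (auto simp: t_def)
  have K: "K \<ge> k0" "K \<ge> 1" "I / t \<le> K" by (auto simp: K_def)
  have lev: "K \<le> K * (2 - 1 / 2 ^ n)" "K * (2 - 1 / 2 ^ n) \<le> 2 * K" for n :: nat
  proof -
    have "1 / 2 ^ n \<le> (1::real)" by simp
    then show "K \<le> K * (2 - 1 / 2 ^ n)" using K by (simp add: field_simps) 
    show "K * (2 - 1 / 2 ^ n) \<le> 2 * K" using K by (simp add: field_simps)
  qed
  have g0: "g n \<ge> 0" for n using F0 K by (auto simp: g_def)
  have rec: "g (Suc n) \<le> (2 * C) * b ^ Suc n * g n powr (1 + \<epsilon>)" for n
  proof -
    let ?k = "K * (2 - 1 / 2 ^ n)" and ?l = "K * (2 - 1 / 2 ^ Suc n)"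
    have diff: "?l - ?k = K / 2 ^ Suc n" by (simp add: field_simps)
    have "0 < ?k" using lev(1)[of n] K by linarith
    moreover have "?k < ?l" using diff K by (smt (verit) zero_less_divide_iff zero_less_power)
    ultimately have "measure M {x \<in> space M. ?l < m x} \<le> F ?k / (?l - ?k)"
      unfolding F_def by (rule measure_superlevel_le)
    also have "\<dots> = 2 ^ Suc n * g n"
      unfolding diff g_def using K by (simp add: field_simps)
    finally have meas_le: "measure M {x \<in> space M. ?l < m x} \<le> 2 ^ Suc n * g n" .
    have "F ?l \<le> C * ?l * measure M {x \<in> space M. ?l < m x} powr (1 + \<epsilon>)"
      unfolding F_def using lev(1)[of "Suc n"] K by (intro decay) linarith
    also have "\<dots> \<le> C * (2 * K) * (2 ^ Suc n * g n) powr (1 + \<epsilon>)"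
    proof (rule mult_mono)
      show "C * ?l \<le> C * (2 * K)" by (rule mult_left_mono[OF lev(2) assms(1)])
      show "measure M {x \<in> space M. ?l < m x} powr (1 + \<epsilon>) \<le> (2 ^ Suc n * g n) powr (1 + \<epsilon>)"
        by (rule powr_mono2[OF _ measure_nonneg meas_le]) (use assms(2) in simp)
    qed (use assms(1) K(2) in simp_all)
    also have "(2 ^ Suc n * g n) powr (1 + \<epsilon>) = b ^ Suc n * g n powr (1 + \<epsilon>)"
    proof -
      have "(2 ^ Suc n :: real) powr (1 + \<epsilon>) = b ^ Suc n"
        by (subst powr_realpow[symmetric])
          (auto simp: b_def powr_power powr_powr algebra_simps simp del: power_Suc of_nat_Suc)
      then show ?thesis by (simp only: powr_mult)
    qed
    finally show ?thesis
      using K unfolding g_def by (simp add: field_simps)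
  qed
  have "g 0 \<le> t"
  proof -
    have "F K \<le> I / K powr (p - 1)"
      unfolding F_def I_def using K by (intro integral_excess_le) linarith
    also have "\<dots> \<le> I / 1"
      using K I0 p by (intro divide_left_mono ge_one_powr_ge_zero) auto
    finally have "F K / K \<le> I / K" using K by (simp add: divide_right_mono)
    also have "\<dots> \<le> t" using K t0 by (simp add: field_simps)
    finally show ?thesis by (simp add: g_def)
  qed
  then have "g 0 powr \<epsilon> \<le> t powr \<epsilon>" using g0 assms by (intro powr_mono2) auto
  also have "t powr \<epsilon> = 1 / (Q + 1)" using Q0 assms by (simp add: t_def powr_powr)
  finally have "Q * g 0 powr \<epsilon> \<le> Q * (1 / (Q + 1))" using Q0 by (intro mult_left_mono)
  also have "\<dots> \<le> 1" using Q0 by (simp add: field_simps)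
  finally have small: "2 * C * b * b powr (1 / \<epsilon>) * g 0 powr \<epsilon> \<le> 1" by (simp add: Q_def)
  have decayg: "g n \<le> g 0 * (b powr (- 1 / \<epsilon>)) ^ n" for n
    by (rule superlinear_recursion_decay[OF _ b1 \<open>0 < \<epsilon>\<close> g0 rec small]) (use assms in auto)
  have "b powr (- 1 / \<epsilon>) < 1" using b1 assms by (subst powr_less_one) auto
  then have "(\<lambda>n. K * (g 0 * (b powr (- 1 / \<epsilon>)) ^ n)) \<longlonglongrightarrow> K * (g 0 * 0)"
    by (intro tendsto_mult tendsto_const LIMSEQ_realpow_zero) auto
  moreover have "F (2 * K) \<le> K * (g 0 * (b powr (- 1 / \<epsilon>)) ^ n)" for n
  proof -
    have "F (2 * K) \<le> F (K * (2 - 1 / 2 ^ n))"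
      unfolding F_def using lev[of n] K by (intro integral_excess_antimono) linarith+
    also have "\<dots> = K * g n" using K by (simp add: g_def)
    finally show ?thesis using decayg[of n] K by (smt (verit) mult_left_mono)
  qed
  ultimately have "F (2 * K) \<le> 0"
    by (intro LIMSEQ_le_const) auto
  then have "F (2 * K) = 0" using F0 by (simp add: antisym)
  then have "AE x in M. max 0 (m x - 2 * K) = 0"
    unfolding F_def using K integrable_excess[of "2 * K"]
    by (subst (asm) integral_nonneg_eq_0_iff_AE) auto
  then have "AE x in M. m x \<le> 2 * K" by eventually_elim auto
  then show ?thesis by blast
qed

text \<open>
  Up to constants, \<open>m powr (p - 1)\<close> is at most \<open>(m - k) powr (p - 1) + k powr (p - 1)\<close> above level
  \<open>k\<close>. For large \<open>k\<close> the first part is absorbed into the left-hand side, as the superlevel set is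
  small. What remains bounds the \<open>p\<close>-th power of the excess by its first power, and comparing the
  two by Young's inequality with a suitable parameter leaves a pure decay condition for the first
  power.
\<close>

lemma bounded_of_caccioppoli:
  assumes "0 \<le> C" and "0 < \<delta>" and "0 < k0"
    and cacc: "\<And>k. k \<ge> k0 \<Longrightarrow> (LINT x|M. max 0 (m x - k) powr p)
       \<le> C * measure M {x \<in> space M. k < m x} powr \<delta> * (LINT x|M. m x powr (p - 1) * max 0 (m x - k))"
  shows "\<exists>K. AE x in M. m x \<le> K"
proof -
  define a where "a k = measure M {x \<in> space M. k < m x}" for k
  define F where "F k = (LINT x|M. max 0 (m x - k))" for k
  define G where "G k = (LINT x|M. max 0 (m x - k) powr p)" for k
  define D where "D = 2 powr p * (C + 1)"
  define I where "I = (LINT x|M. m x powr p)"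
  define c where "c = (1 / D) powr (1 / \<delta>)"
  define k1 where "k1 = 1 + max k0 (I / c)"
  have I0: "I \<ge> 0" unfolding I_def by (rule Bochner_Integration.integral_nonneg) auto
  have F0: "F k \<ge> 0" for k unfolding F_def by (rule Bochner_Integration.integral_nonneg) auto
  have G0: "G k \<ge> 0" for k unfolding G_def by (rule Bochner_Integration.integral_nonneg) auto
  have D: "D > 0" "2 powr p * C \<le> D" using assms by (auto simp: D_def intro!: mult_pos_pos)
  have c: "c > 0" using D by (simp add: c_def)
  have intG: "integrable M (\<lambda>x. max 0 (m x - k) powr p)" if "k > 0" for k
    by (rule Bochner_Integration.integrable_bound[OF int_p])
       (use that nonneg p in \<open>auto intro!: powr_mono2\<close>)
  have main: "F k \<le> 2 * (2 * D) powr (1 / (p - 1)) * k * a k powr (1 + \<delta> / (p - 1))"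
    if k: "k \<ge> k1" for k
  proof (cases "a k = 0")
    case True
    have "k > 0" using k assms(3) by (auto simp: k1_def)
    then have "{x \<in> space M. k < m x} \<in> null_sets M"
      using True finite_superlevel[of k] by (auto simp: a_def measure_def enn2real_eq_0_iff)
    then have "AE x in M. max 0 (m x - k) = 0"
      by (rule AE_I') auto
    then have "F k = 0" unfolding F_def by (rule integral_eq_zero_AE)
    then show ?thesis using True by simp
  next
    case False
    then have apos: "a k > 0" by (simp add: a_def zero_less_measure_iff)
    have kpos: "k > 0" "k \<ge> k0" "k \<ge> 1" using k assms(3) by (auto simp: k1_def)
    have absorb: "D * a k powr \<delta> \<le> 1"
    proof -
      have "I / c \<le> k" using k by (auto simp: k1_def)
      have "a k \<le> I / k powr p"
        unfolding a_def I_def using kpos by (intro measure_superlevel_le_powr) auto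
      also have "\<dots> \<le> I / k powr 1"
        using kpos I0 p by (intro divide_left_mono powr_mono mult_pos_pos) auto
      also have "\<dots> \<le> c" using \<open>I / c \<le> k\<close> c kpos by (simp add: field_simps)
      finally have "a k powr \<delta> \<le> c powr \<delta>" using apos assms by (intro powr_mono2) auto
      also have "\<dots> = 1 / D" using D assms by (simp add: c_def powr_powr)
      finally show ?thesis using D by (simp add: field_simps)
    qed
    \<comment> \<open>Above level \<open>k\<close>, \<open>m x\<close> is comparable to \<open>k\<close> if \<open>m x \<le> 2 * k\<close>, and to \<open>m x - k\<close> otherwise.\<close>
    have pointwise: "m x powr (p - 1) * max 0 (m x - k)
        \<le> 2 powr (p - 1) * (max 0 (m x - k) powr p + k powr (p - 1) * max 0 (m x - k))" for x
    proof (cases "m x \<le> 2 * k")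
      case True
      have "m x powr (p - 1) \<le> (2 * k) powr (p - 1)"
        using True nonneg p by (intro powr_mono2) auto
      then have "m x powr (p - 1) * max 0 (m x - k) \<le> (2 * k) powr (p - 1) * max 0 (m x - k)"
        by (intro mult_right_mono) auto
      then show ?thesis using kpos by (simp add: powr_mult algebra_simps) (smt (verit) powr_ge_zero mult_nonneg_nonneg)
    next
      case False
      have "m x powr (p - 1) \<le> (2 * (m x - k)) powr (p - 1)"
        using False nonneg p by (intro powr_mono2) auto
      then have "m x powr (p - 1) * (m x - k) \<le> (2 * (m x - k)) powr (p - 1) * (m x - k)"
        using False kpos by (intro mult_right_mono) auto
      also have "\<dots> = 2 powr (p - 1) * ((m x - k) * (m x - k) powr (p - 1))"
        using False kpos powr_mult[of 2 "m x - k" "p - 1"] by (simp only: mult.assoc mult.commute mult.left_commute)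
      also have "(m x - k) * (m x - k) powr (p - 1) = (m x - k) powr p"
        using False kpos by (subst powr_mult_base) auto
      finally have "m x powr (p - 1) * (m x - k) \<le> 2 powr (p - 1) * (m x - k) powr p" .
      moreover have "0 \<le> 2 powr (p - 1) * (k powr (p - 1) * (m x - k))" using False kpos by simp
      moreover have "max 0 (m x - k) = m x - k" using False kpos by simp
      ultimately show ?thesis unfolding distrib_left by linarith
    qed
    have "(LINT x|M. m x powr (p - 1) * max 0 (m x - k))
        \<le> (LINT x|M. 2 powr (p - 1) * (max 0 (m x - k) powr p + k powr (p - 1) * max 0 (m x - k)))"
      using kpos intG integrable_excess pointwise
      by (intro integral_mono' integrable_mult_right Bochner_Integration.integrable_add) auto
    also have "\<dots> = 2 powr (p - 1) * (G k + k powr (p - 1) * F k)"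
      using kpos intG integrable_excess by (simp add: G_def F_def)
    finally have rhs: "(LINT x|M. m x powr (p - 1) * max 0 (m x - k)) \<le> \<dots>" .
    define E where "E = D * a k powr \<delta>"
    have E: "0 < E" "E \<le> 1" using absorb D apos by (auto simp: E_def)
    have "G k \<le> C * a k powr \<delta> * (2 powr (p - 1) * (G k + k powr (p - 1) * F k))"
      using cacc[of k] kpos mult_left_mono[OF rhs, of "C * a k powr \<delta>"] assms(1)
      by (simp add: G_def a_def)
    also have "\<dots> = (2 powr p * C) * a k powr \<delta> / 2 * (G k + k powr (p - 1) * F k)"
      by (simp add: powr_diff)
    also have "\<dots> \<le> E / 2 * (G k + k powr (p - 1) * F k)"
      unfolding E_def using D G0 F0 by (intro mult_right_mono divide_right_mono) auto
    finally have "G k \<le> E / 2 * (G k + k powr (p - 1) * F k)" .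
    moreover have "E / 2 * G k \<le> 1 / 2 * G k"
      using E G0 by (intro mult_right_mono) auto
    ultimately have GF: "G k \<le> E * (k powr (p - 1) * F k)"
      by (simp add: distrib_left)
    \<comment> \<open>The parameter in Young's inequality is chosen so that the term with \<open>G k\<close> is at most \<open>F k / 2\<close>.\<close>
    define \<theta> where "\<theta> = k * (2 * E) powr (1 / (p - 1))"
    have \<theta>: "\<theta> > 0" using kpos E by (simp add: \<theta>_def)
    have \<theta>p: "\<theta> powr (p - 1) = k powr (p - 1) * (2 * E)"
      using kpos E p by (simp add: \<theta>_def powr_mult powr_powr)
    have young: "max 0 (m x - k) \<le> \<theta> * indicator {x \<in> space M. k < m x} x + max 0 (m x - k) powr p / \<theta> powr (p - 1)"
      if "x \<in> space M" for x
    proof (cases "m x - k \<le> \<theta>")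
      case True
      then show ?thesis using that \<theta> by (auto simp: indicator_def intro: add_increasing2)
    next
      case False
      then have "(m x - k) * \<theta> powr (p - 1) \<le> (m x - k) * (m x - k) powr (p - 1)"
        using \<theta> p by (intro mult_left_mono powr_mono2) auto
      also have "\<dots> = (m x - k) powr p" using False \<theta> by (subst powr_mult_base) auto
      finally have "m x - k \<le> (m x - k) powr p / \<theta> powr (p - 1)" using \<theta> by (simp add: field_simps)
      then show ?thesis using False \<theta> that by (auto simp: indicator_def)
    qed
    have ind: "integrable M (indicator {x \<in> space M. k < m x} :: _ \<Rightarrow> real)"
      using finite_superlevel[of k] kpos by (intro integrable_real_indicator) auto
    have "F k \<le> (LINT x|M. \<theta> * indicator {x \<in> space M. k < m x} x + max 0 (m x - k) powr p / \<theta> powr (p - 1))"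
      unfolding F_def using kpos intG ind integrable_excess young by (intro integral_mono) auto
    also have "\<dots> = \<theta> * a k + G k / \<theta> powr (p - 1)"
      using kpos intG ind by (simp add: a_def G_def superlevel_Int_space)
    also have "G k / \<theta> powr (p - 1) \<le> F k / 2"
      using GF kpos E unfolding \<theta>p by (simp add: field_simps)
    finally have "F k \<le> 2 * \<theta> * a k" by simp
    also have "\<dots> = 2 * (2 * D) powr (1 / (p - 1)) * k * (a k * (a k powr \<delta>) powr (1 / (p - 1)))"
      using D apos by (simp add: \<theta>_def E_def powr_mult)
    also have "a k * (a k powr \<delta>) powr (1 / (p - 1)) = a k powr (1 + \<delta> / (p - 1))"
      using apos by (simp add: powr_add powr_powr)
    finally show ?thesis .
  qed
  show ?thesis
    by (rule bounded_of_superlevel_decay[OF _ _ _ main[unfolded F_def a_def]])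
       (use assms p c I0 in \<open>auto simp: k1_def\<close>)
qed

end

section \<open>Soft thresholds\<close>

text \<open>
  For \<open>k \<ge> 0\<close> this equals \<open>sgn \<tau> * max 0 (\<bar>\<tau>\<bar> - k)\<close>: the values in \<open>[-k, k]\<close> are
  cut off, and the remaining ones are shifted so that no jump arises.
\<close>

definition soft_threshold :: "real \<Rightarrow> real \<Rightarrow> real" where
  "soft_threshold k \<tau> = \<tau> - max (- k) (min k \<tau>)"

lemma abs_soft_threshold: "0 \<le> k \<Longrightarrow> \<bar>soft_threshold k \<tau>\<bar> = max 0 (\<bar>\<tau>\<bar> - k)"
  by (auto simp: soft_threshold_def)

lemma soft_threshold_0: "0 \<le> k \<Longrightarrow> soft_threshold k 0 = 0"
  by (auto simp: soft_threshold_def)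

lemma soft_threshold_lipschitz: "\<bar>soft_threshold k a - soft_threshold k b\<bar> \<le> \<bar>a - b\<bar>"
  by (auto simp: soft_threshold_def max_def min_def abs_if)

lemma soft_threshold_mono: "a \<le> b \<Longrightarrow> soft_threshold k a \<le> soft_threshold k b"
  by (auto simp: soft_threshold_def max_def min_def)

lemma soft_threshold_diff_sign: "0 \<le> (a - b) * (soft_threshold k a - soft_threshold k b)"
proof (cases "a \<le> b")
  case True
  then show ?thesis using soft_threshold_mono[OF True, of k] by (intro mult_nonpos_nonpos) auto
next
  case False
  then show ?thesis using soft_threshold_mono[of b a k] by (intro mult_nonneg_nonneg) auto
qed

lemma borel_measurable_soft_threshold [measurable]: "soft_threshold k \<in> borel_measurable borel"
  unfolding soft_threshold_def by measurable

text \<open>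
  In the application \<open>d\<close> is an increment of a function and \<open>e\<close> the increment of its truncation. The
  first bound makes truncations good test functions for the fractional \<open>p\<close>-Laplacian; the second
  one makes the corresponding integrand integrable.
\<close>

lemma powr_le_plap_kernel:
  fixes d e p :: real
  assumes "1 < p" and "0 \<le> d * e" and "\<bar>e\<bar> \<le> \<bar>d\<bar>"
  shows "\<bar>e\<bar> powr p \<le> \<bar>d\<bar> powr (p - 2) * d * e"
    and "\<bar>d\<bar> powr (p - 2) * d * e \<le> \<bar>d\<bar> powr p"
proof -
  have kernel: "\<bar>d\<bar> powr (p - 2) * d * e = \<bar>e\<bar> * \<bar>d\<bar> powr (p - 1)"
  proof -
    have "d * e = \<bar>d\<bar> * \<bar>e\<bar>" using assms(2) by (simp flip: abs_mult)
    moreover have "\<bar>d\<bar> * \<bar>d\<bar> powr (p - 2) = \<bar>d\<bar> powr (p - 1)"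
      by (subst powr_mult_base) auto
    ultimately show ?thesis by (metis mult.assoc mult.commute)
  qed
  have "\<bar>e\<bar> powr p = \<bar>e\<bar> * \<bar>e\<bar> powr (p - 1)" by (subst powr_mult_base) auto
  also have "\<dots> \<le> \<bar>e\<bar> * \<bar>d\<bar> powr (p - 1)" using assms by (intro mult_left_mono powr_mono2) auto
  finally show "\<bar>e\<bar> powr p \<le> \<bar>d\<bar> powr (p - 2) * d * e" by (simp only: kernel)
  have "\<bar>e\<bar> * \<bar>d\<bar> powr (p - 1) \<le> \<bar>d\<bar> * \<bar>d\<bar> powr (p - 1)" using assms by (intro mult_right_mono) auto
  also have "\<dots> = \<bar>d\<bar> powr p" by (subst powr_mult_base) auto
  finally show "\<bar>d\<bar> powr (p - 2) * d * e \<le> \<bar>d\<bar> powr p" by (simp only: kernel)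
qed

section \<open>Lebesgue measurability of functions of one coordinate\<close>

text \<open>
  The double integrals are taken over the completed product measure, and a function that is merely
  Lebesgue measurable has to be lifted to it. This works because a cylinder over a null set is a
  null set.
\<close>

lemma null_sets_lborel_times:
  fixes N :: "'a::euclidean_space set" and S :: "'b::euclidean_space set"
  shows "N \<in> null_sets lborel \<Longrightarrow> N \<times> (UNIV :: 'b set) \<in> null_sets lborel"
    and "S \<in> null_sets lborel \<Longrightarrow> (UNIV :: 'a set) \<times> S \<in> null_sets lborel"
  unfolding lborel_prod[symmetric]
  by (auto simp: null_sets_def lborel.emeasure_pair_measure_Times)

lemma measurable_fst_lebesgue:
  "fst \<in> measurable (lebesgue :: ('a::euclidean_space \<times> 'b::euclidean_space) measure) lebesgue"
proof (rule completion.measurable_completion2)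
  show *: "fst \<in> measurable (lebesgue :: ('a \<times> 'b) measure) lborel"
    by (rule measurable_completion) (simp flip: lborel_prod)
  show "null_sets lborel \<subseteq> null_sets (distr (lebesgue :: ('a \<times> 'b) measure) lborel fst)"
  proof
    fix N :: "'a set" assume N: "N \<in> null_sets lborel"
    have "fst -` N = N \<times> (UNIV :: 'b set)" by auto
    then show "N \<in> null_sets (distr (lebesgue :: ('a \<times> 'b) measure) lborel fst)"
      using N null_sets_lborel_times(1)[OF N, where 'b='b] *
      by (auto simp: null_sets_distr_iff intro: null_sets_completionI)
  qed
qed

lemma measurable_snd_lebesgue:
  "snd \<in> measurable (lebesgue :: ('a::euclidean_space \<times> 'b::euclidean_space) measure) lebesgue"
proof (rule completion.measurable_completion2)
  show *: "snd \<in> measurable (lebesgue :: ('a \<times> 'b) measure) lborel"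
    by (rule measurable_completion) (simp flip: lborel_prod)
  show "null_sets lborel \<subseteq> null_sets (distr (lebesgue :: ('a \<times> 'b) measure) lborel snd)"
  proof
    fix N :: "'b set" assume N: "N \<in> null_sets lborel"
    have "snd -` N = (UNIV :: 'a set) \<times> N" by auto
    then show "N \<in> null_sets (distr (lebesgue :: ('a \<times> 'b) measure) lborel snd)"
      using N null_sets_lborel_times(2)[OF N, where 'a='a] *
      by (auto simp: null_sets_distr_iff intro: null_sets_completionI)
  qed
qed

lemma borel_measurable_lebesgue_coordinates:
  fixes w :: "'a::euclidean_space \<Rightarrow> real"
  assumes "w \<in> borel_measurable lebesgue"
  shows "(\<lambda>z::'a \<times> 'b::euclidean_space. w (fst z)) \<in> borel_measurable lebesgue"
    and "(\<lambda>z::'b \<times> 'a. w (snd z)) \<in> borel_measurable lebesgue"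
  using measurable_compose[OF measurable_fst_lebesgue assms]
    measurable_compose[OF measurable_snd_lebesgue assms] by auto

lemma borel_measurable_lebesgue_norm_diff:
  "(\<lambda>z::'a \<times> 'a::euclidean_space. norm (fst z - snd z)) \<in> borel_measurable lebesgue"
  by (rule measurable_completion) (simp flip: lborel_prod)

lemma AE_lborel_fst:
  assumes "AE x in lborel. P x"
  shows "AE z in (lborel :: ('a::euclidean_space \<times> 'b::euclidean_space) measure). P (fst z)"
proof -
  obtain N where N: "N \<in> null_sets lborel" "{x. \<not> P x} \<subseteq> N"
    using assms by (auto simp: eventually_ae_filter)
  show ?thesis
    by (rule AE_I'[OF null_sets_lborel_times(1)[OF N(1)]]) (use N in auto)
qed

lemma AE_lborel_snd:
  assumes "AE x in lborel. P x"
  shows "AE z in (lborel :: ('a::euclidean_space \<times> 'b::euclidean_space) measure). P (snd z)"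
proof -
  obtain N where N: "N \<in> null_sets lborel" "{x. \<not> P x} \<subseteq> N"
    using assms by (auto simp: eventually_ae_filter)
  show ?thesis
    by (rule AE_I'[OF null_sets_lborel_times(2)[OF N(1)]]) (use N in auto)
qed

lemma gagliardo_density_measurable:
  fixes w :: "'a::euclidean_space \<Rightarrow> real"
  assumes "w \<in> borel_measurable lebesgue"
  shows "gagliardo_density t p w \<in> borel_measurable lebesgue"
proof -
  note [measurable] = borel_measurable_lebesgue_coordinates[OF assms] borel_measurable_lebesgue_norm_diff
  show ?thesis
    unfolding gagliardo_density_def case_prod_unfold by measurable
qed

section \<open>The fractional Faber-Krahn inequality\<close>

text \<open>
  Since the support of \<open>w\<close> fills at most half of the volume of any ball of radius \<open>R\<close>, the other
  half consists of points \<open>y\<close> with \<open>w y = 0\<close> and \<open>norm (x - y) < R\<close>. Integrating the density over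
  these \<open>y\<close> alone already recovers \<open>\<bar>w x\<bar> powr p\<close>.
\<close>

lemma nn_integral_faber_krahn:
  fixes w :: "'a::euclidean_space \<Rightarrow> real"
  assumes [measurable]: "w \<in> borel_measurable borel" and "0 < R" and "0 < t" and "0 < p"
    and small: "emeasure lborel {x. w x \<noteq> 0} \<le> ennreal (measure lborel (ball (0::'a) R) / 2)"
  shows "(\<integral>\<^sup>+x. ennreal (\<bar>w x\<bar> powr p) \<partial>lborel)
           * ennreal (measure lborel (ball (0::'a) R) / 2 / R powr (real DIM('a) + t * p))
         \<le> (\<integral>\<^sup>+z. ennreal (gagliardo_density t p w z) \<partial>lborel)"
proof -
  define V where "V = measure lborel (ball (0::'a) R)"
  define c where "c = 1 / R powr (real DIM('a) + t * p)"
  have V: "V \<ge> 0" by (simp add: V_def)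
  have c: "c \<ge> 0" by (simp add: c_def)
  have [measurable]: "(\<lambda>z. ennreal (gagliardo_density t p w z)) \<in> borel_measurable (lborel \<Otimes>\<^sub>M lborel)"
    unfolding gagliardo_density_def case_prod_unfold by measurable
  have complement: "ennreal (V / 2) \<le> emeasure lborel (ball x R - {x. w x \<noteq> 0})" for x
  proof -
    have "ennreal (V / 2) + ennreal (V / 2) = ennreal V"
      using V by (simp flip: ennreal_plus)
    also have "\<dots> = emeasure lborel (ball x R)"
      using \<open>0 < R\<close> by (simp add: V_def emeasure_ball content_ball)
    also have "\<dots> \<le> emeasure lborel ({x. w x \<noteq> 0} \<union> (ball x R - {x. w x \<noteq> 0}))"
      by (intro emeasure_mono) auto
    also have "\<dots> \<le> emeasure lborel {x. w x \<noteq> 0} + emeasure lborel (ball x R - {x. w x \<noteq> 0})"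
      by (intro emeasure_subadditive) auto
    also have "\<dots> \<le> ennreal (V / 2) + emeasure lborel (ball x R - {x. w x \<noteq> 0})"
      using small by (intro add_right_mono) (simp add: V_def)
    finally show ?thesis
      by (simp add: ennreal_add_left_cancel_le)
  qed
  have slice: "ennreal (\<bar>w x\<bar> powr p) * ennreal (V / 2 * c)
      \<le> (\<integral>\<^sup>+y. ennreal (gagliardo_density t p w (x, y)) \<partial>lborel)" for x
  proof (cases "w x = 0")
    case False
    let ?S = "ball x R - {x. w x \<noteq> 0}"
    have "ennreal (\<bar>w x\<bar> powr p) * ennreal (V / 2 * c) = ennreal (\<bar>w x\<bar> powr p * c) * ennreal (V / 2)"
      using V c by (simp add: mult_ac flip: ennreal_mult)
    also have "\<dots> \<le> ennreal (\<bar>w x\<bar> powr p * c) * emeasure lborel ?S"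
      by (intro mult_left_mono complement) auto
    also have "\<dots> = (\<integral>\<^sup>+y. ennreal (\<bar>w x\<bar> powr p * c) * indicator ?S y \<partial>lborel)"
      by (subst nn_integral_cmult_indicator) auto
    also have "\<dots> \<le> (\<integral>\<^sup>+y. ennreal (gagliardo_density t p w (x, y)) \<partial>lborel)"
    proof (rule nn_integral_mono)
      fix y
      show "ennreal (\<bar>w x\<bar> powr p * c) * indicator ?S y \<le> ennreal (gagliardo_density t p w (x, y))"
      proof (cases "y \<in> ?S")
        case True
        then have "w y = 0" "norm (x - y) \<le> R" "0 < norm (x - y)"
          using False by (auto simp: dist_norm)
        moreover then have "norm (x - y) powr (real DIM('a) + t * p) \<le> R powr (real DIM('a) + t * p)"
          using assms by (intro powr_mono2) auto
        ultimately show ?thesis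
          using True by (auto simp: gagliardo_density_def c_def intro!: ennreal_leI divide_left_mono mult_pos_pos)
      qed simp
    qed
    finally show ?thesis .
  qed simp
  have "(\<integral>\<^sup>+x. ennreal (\<bar>w x\<bar> powr p) \<partial>lborel) * ennreal (V / 2 * c)
      = (\<integral>\<^sup>+x. ennreal (\<bar>w x\<bar> powr p) * ennreal (V / 2 * c) \<partial>lborel)"
    by (subst nn_integral_multc) auto
  also have "\<dots> \<le> (\<integral>\<^sup>+x. \<integral>\<^sup>+y. ennreal (gagliardo_density t p w (x, y)) \<partial>lborel \<partial>lborel)"
    by (intro nn_integral_mono slice)
  also have "\<dots> = (\<integral>\<^sup>+z. ennreal (gagliardo_density t p w z) \<partial>(lborel \<Otimes>\<^sub>M lborel))"
    by (rule lborel.nn_integral_fst) measurable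
  finally show ?thesis
    by (simp add: lborel_prod V_def c_def)
qed

text \<open>
  The radius is kept as a parameter, so that one ball can serve two functions of different orders
  \<open>t\<close> with supports in a common set. Choosing it such that the ball has exactly twice the measure
  of \<open>A\<close> turns \<open>R powr (t * p)\<close> into a constant times \<open>measure lebesgue A powr (t * p / DIM('a))\<close>.
\<close>

lemma fractional_faber_krahn:
  fixes w :: "'a::euclidean_space \<Rightarrow> real"
  assumes meas: "w \<in> borel_measurable lebesgue" and "0 < R" and "0 < t" and "0 < p"
    and int_p: "integrable lebesgue (\<lambda>x. \<bar>w x\<bar> powr p)"
    and int_density: "integrable lebesgue (gagliardo_density t p w)"
    and A: "A \<in> lmeasurable" and support: "\<And>x. x \<notin> A \<Longrightarrow> w x = 0"
    and small: "measure lebesgue A \<le> measure lborel (ball (0::'a) R) / 2"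
  shows "(LINT x|lebesgue. \<bar>w x\<bar> powr p)
           \<le> 2 / measure lborel (ball (0::'a) 1) * R powr (t * p) * gagliardo_pow t p w"
proof -
  \<comment> \<open>Tonelli's theorem needs a Borel representative.\<close>
  obtain w' where w' [measurable]: "w' \<in> borel_measurable lborel" and eq: "AE x in lborel. w x = w' x"
    using completion_ex_borel_measurable_real[OF meas] by auto
  let ?V = "measure lborel (ball (0::'a) R) / 2 / R powr (real DIM('a) + t * p)"
  have "emeasure lborel {x. w' x \<noteq> 0} = emeasure lebesgue {x. w' x \<noteq> 0}"
    by (subst emeasure_completion) auto
  also have "\<dots> \<le> emeasure lebesgue A"
  proof (rule emeasure_mono_AE)
    show "AE x in lebesgue. x \<in> {x. w' x \<noteq> 0} \<longrightarrow> x \<in> A"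
      using AE_completion[OF eq] by eventually_elim (metis mem_Collect_eq support)
  qed (use A in auto)
  also have "\<dots> \<le> ennreal (measure lborel (ball (0::'a) R) / 2)"
    using small A by (simp add: emeasure_eq_measure2 ennreal_leI)
  finally have small': "emeasure lborel {x. w' x \<noteq> 0} \<le> \<dots>" .
  have "ennreal ((LINT x|lebesgue. \<bar>w x\<bar> powr p) * ?V)
      = (\<integral>\<^sup>+x. ennreal (\<bar>w x\<bar> powr p) \<partial>lborel) * ennreal ?V"
  proof -
    have "(\<integral>\<^sup>+x. ennreal (\<bar>w x\<bar> powr p) \<partial>lborel) = ennreal (LINT x|lebesgue. \<bar>w x\<bar> powr p)"
      using nn_integral_eq_integral[OF int_p] by (simp add: nn_integral_completion)
    moreover have "0 \<le> ?V" by simp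
    ultimately show ?thesis by (simp only: ennreal_mult'')
  qed
  also have "(\<integral>\<^sup>+x. ennreal (\<bar>w x\<bar> powr p) \<partial>lborel) = (\<integral>\<^sup>+x. ennreal (\<bar>w' x\<bar> powr p) \<partial>lborel)"
    using eq by (intro nn_integral_cong_AE) auto
  also have "\<dots> * ennreal ?V \<le> (\<integral>\<^sup>+z. ennreal (gagliardo_density t p w' z) \<partial>lborel)"
    using nn_integral_faber_krahn[of w' R t p] small' w' assms by simp
  also have "\<dots> = (\<integral>\<^sup>+z. ennreal (gagliardo_density t p w z) \<partial>lborel)"
    using AE_lborel_fst[OF eq, where 'b='a] AE_lborel_snd[OF eq, where 'a='a]
    by (intro nn_integral_cong_AE, eventually_elim) (auto simp: gagliardo_density_def case_prod_unfold)
  also have "\<dots> = ennreal (gagliardo_pow t p w)"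
    unfolding gagliardo_pow_def using int_density
    by (subst nn_integral_completion[symmetric], subst nn_integral_eq_integral)
       (auto simp: gagliardo_density_def case_prod_unfold)
  finally have "(LINT x|lebesgue. \<bar>w x\<bar> powr p) * ?V \<le> gagliardo_pow t p w"
    by (subst (asm) ennreal_le_iff)
      (auto simp: gagliardo_pow_def gagliardo_density_def case_prod_unfold intro!: Bochner_Integration.integral_nonneg)
  also have "?V = measure lborel (ball (0::'a) 1) / (2 * R powr (t * p))"
    using \<open>0 < R\<close> by (simp add: content_ball_conv_unit_ball[of R] powr_add powr_realpow)
  finally show ?thesis
    using \<open>0 < R\<close> by (simp add: field_simps)
qed

section \<open>Energy estimate for the truncations\<close>

lemma frac_sobolev_zeroD:
  assumes "u \<in> frac_sobolev_zero t p \<Omega>"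
  shows "u \<in> borel_measurable lebesgue" and "integrable lebesgue (\<lambda>x. \<bar>u x\<bar> powr p)"
    and "integrable lebesgue (gagliardo_density t p u)" and "x \<notin> \<Omega> \<Longrightarrow> u x = 0"
  using assms by (auto simp: frac_sobolev_zero_def frac_sobolev_def lebesgue_on_UNIV_eq)

lemma integrable_lebesgue_on_subset:
  fixes f :: "'a::euclidean_space \<Rightarrow> real"
  assumes "integrable lebesgue f" and "S \<in> sets lebesgue"
  shows "integrable (lebesgue_on S) f"
  using assms integrable_mult_indicator[OF assms(2,1)] by (simp add: integrable_restrict_space)

lemma gagliardo_density_contraction:
  assumes "\<And>x y. \<bar>f x - f y\<bar> \<le> \<bar>u x - u y\<bar>" and "0 \<le> p"
  shows "gagliardo_density t p f z \<le> gagliardo_density t p u z"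
  using assms unfolding gagliardo_density_def case_prod_unfold
  by (intro divide_right_mono powr_mono2) auto

lemma gagliardo_density_nonneg: "0 \<le> gagliardo_density t p f z"
  by (auto simp: gagliardo_density_def case_prod_unfold)

text \<open>
  A 1-Lipschitz function that fixes \<open>0\<close> diminishes both \<open>\<bar>u\<bar>\<close> and the Gagliardo density, and keeps
  the zero values outside \<open>\<Omega>\<close>.
\<close>

lemma soft_threshold_in_frac_sobolev_zero:
  fixes u :: "'a::euclidean_space \<Rightarrow> real"
  assumes u: "u \<in> frac_sobolev_zero t p \<Omega>" and "open \<Omega>" and "0 \<le> k" and "0 < p"
  shows "(\<lambda>x. soft_threshold k (u x)) \<in> frac_sobolev_zero t p \<Omega>"
proof -
  let ?w = "\<lambda>x. soft_threshold k (u x)"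
  note [measurable] = frac_sobolev_zeroD(1)[OF u]
  have meas: "?w \<in> borel_measurable lebesgue" by measurable
  have int_p: "integrable lebesgue (\<lambda>x. \<bar>?w x\<bar> powr p)"
    by (rule Bochner_Integration.integrable_bound[OF frac_sobolev_zeroD(2)[OF u]])
       (use assms in \<open>auto simp: abs_soft_threshold intro!: powr_mono2\<close>)
  have int_density: "integrable lebesgue (gagliardo_density t p ?w)"
    by (rule Bochner_Integration.integrable_bound[OF frac_sobolev_zeroD(3)[OF u]
          gagliardo_density_measurable[OF meas]])
       (use assms in \<open>auto simp: gagliardo_density_nonneg
          intro!: gagliardo_density_contraction soft_threshold_lipschitz\<close>)
  have \<Omega>: "\<Omega> \<in> sets lebesgue" "\<Omega> \<times> \<Omega> \<in> sets lebesgue"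
    using \<open>open \<Omega>\<close> open_Times[OF \<open>open \<Omega>\<close> \<open>open \<Omega>\<close>]
    by (metis borel_open sets_completionI_sets sets_lborel)+
  show ?thesis
    unfolding frac_sobolev_zero_def frac_sobolev_def
    using meas int_p int_density \<Omega> assms frac_sobolev_zeroD(4)[OF u]
    by (auto simp: lebesgue_on_UNIV_eq soft_threshold_0
        intro!: integrable_lebesgue_on_subset measurable_restrict_space1)
qed

lemma gagliardo_pow_soft_threshold_le:
  fixes u :: "'a::euclidean_space \<Rightarrow> real"
  assumes u: "u \<in> frac_sobolev_zero t p \<Omega>" and "1 < p"
  shows "gagliardo_pow t p (\<lambda>x. soft_threshold k (u x))
           \<le> frac_plap_form t p u (\<lambda>x. soft_threshold k (u x))"
proof -
  let ?w = "\<lambda>x. soft_threshold k (u x)"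
  let ?f = "\<lambda>(x, y). \<bar>u x - u y\<bar> powr (p - 2) * (u x - u y) * (?w x - ?w y)
        / norm (x - y) powr (real DIM('a) + t * p)"
  note kernel = powr_le_plap_kernel[OF \<open>1 < p\<close> soft_threshold_diff_sign soft_threshold_lipschitz]
  have le: "gagliardo_density t p ?w z \<le> ?f z" "?f z \<le> gagliardo_density t p u z" for z
    unfolding gagliardo_density_def case_prod_unfold
    by (intro divide_right_mono kernel powr_ge_zero)+
  note [measurable] = borel_measurable_lebesgue_coordinates[OF frac_sobolev_zeroD(1)[OF u]]
    borel_measurable_lebesgue_norm_diff
  have "?f \<in> borel_measurable lebesgue"
    unfolding case_prod_unfold by measurable
  moreover have "0 \<le> ?f z" for z
    using le(1) gagliardo_density_nonneg order_trans by blast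
  ultimately have "integrable lebesgue ?f"
    using le(2) by (intro Bochner_Integration.integrable_bound[OF frac_sobolev_zeroD(3)[OF u]])
      (auto simp: gagliardo_density_nonneg)
  then show ?thesis
    unfolding gagliardo_pow_def frac_plap_form_def
    using le(1) \<open>\<And>z. 0 \<le> ?f z\<close> by (intro integral_mono') auto
qed

text \<open>
  Here \<open>m\<close> is any majorant of \<open>\<bar>u\<bar>\<close>, which may depend on the other component of a system; this is
  how the two equations are decoupled.
\<close>

lemma soft_threshold_energy_estimate:
  fixes u f m :: "'a::euclidean_space \<Rightarrow> real"
  assumes u: "u \<in> frac_sobolev_zero t p \<Omega>" and "open \<Omega>" and "0 < k" and "1 < p" and "0 < t"
    and weak: "frac_plap_form t p u (\<lambda>x. soft_threshold k (u x)) = c * (LINT x|lebesgue_on \<Omega>. f x)"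
    and f: "\<And>x. x \<in> \<Omega> \<Longrightarrow> \<bar>f x\<bar> \<le> m x powr (p - 1) * max 0 (m x - k)"
    and int_rhs: "integrable lebesgue (\<lambda>x. m x powr (p - 1) * max 0 (m x - k))"
    and m: "\<And>x. \<bar>u x\<bar> \<le> m x" 
    and A: "{x. k < m x} \<in> lmeasurable" and "0 < R"
    and small: "measure lebesgue {x. k < m x} \<le> measure lborel (ball (0::'a) R) / 2"
  shows "(LINT x|lebesgue. max 0 (\<bar>u x\<bar> - k) powr p)
           \<le> 2 / measure lborel (ball (0::'a) 1) * R powr (t * p)
               * (\<bar>c\<bar> * (LINT x|lebesgue. m x powr (p - 1) * max 0 (m x - k)))"
proof -
  let ?w = "\<lambda>x. soft_threshold k (u x)"
  let ?J = "LINT x|lebesgue. m x powr (p - 1) * max 0 (m x - k)"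
  have \<Omega>: "\<Omega> \<in> sets lebesgue" using \<open>open \<Omega>\<close> by auto
  note w = soft_threshold_in_frac_sobolev_zero[OF u \<open>open \<Omega>\<close>, of k]
  have "\<bar>LINT x|lebesgue_on \<Omega>. f x\<bar> \<le> (LINT x|lebesgue_on \<Omega>. \<bar>f x\<bar>)"
    by (rule integral_abs_bound)
  also have "\<dots> \<le> (LINT x|lebesgue_on \<Omega>. m x powr (p - 1) * max 0 (m x - k))"
    using f int_rhs \<Omega> by (intro integral_mono' integrable_lebesgue_on_subset) auto
  also have "\<dots> \<le> ?J"
    using int_rhs \<Omega> by (subst integral_restrict_space) (auto intro!: integral_mono' simp: indicator_def)
  finally have rhs: "\<bar>LINT x|lebesgue_on \<Omega>. f x\<bar> \<le> ?J" .
  have "gagliardo_pow t p ?w \<le> c * (LINT x|lebesgue_on \<Omega>. f x)"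
    using gagliardo_pow_soft_threshold_le[OF u \<open>1 < p\<close>, of k] weak by simp
  also have "\<dots> \<le> \<bar>c\<bar> * \<bar>LINT x|lebesgue_on \<Omega>. f x\<bar>"
    by (metis abs_ge_self abs_mult)
  also have "\<dots> \<le> \<bar>c\<bar> * ?J" using rhs by (intro mult_left_mono) auto
  finally have energy: "gagliardo_pow t p ?w \<le> \<bar>c\<bar> * ?J" .
  have "(LINT x|lebesgue. max 0 (\<bar>u x\<bar> - k) powr p) = (LINT x|lebesgue. \<bar>?w x\<bar> powr p)"
    using \<open>0 < k\<close> by (simp add: abs_soft_threshold)
  also have "\<dots> \<le> 2 / measure lborel (ball (0::'a) 1) * R powr (t * p) * gagliardo_pow t p ?w"
  proof (rule fractional_faber_krahn[OF _ \<open>0 < R\<close> \<open>0 < t\<close> _ _ _ A _ small])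
    fix x assume "x \<notin> {x. k < m x}"
    then have "\<bar>?w x\<bar> = 0" using m[of x] \<open>0 < k\<close> by (simp add: abs_soft_threshold)
    then show "?w x = 0" by simp
  qed (use w frac_sobolev_zeroD(1-3)[OF w] assms in auto)
  also have "\<dots> \<le> 2 / measure lborel (ball (0::'a) 1) * R powr (t * p) * (\<bar>c\<bar> * ?J)"
    using energy by (intro mult_left_mono) auto
  finally show ?thesis .
qed

text \<open>
  Both \<open>\<bar>a\<bar>\<close> and \<open>\<bar>b\<bar>\<close> may be replaced by the larger \<open>c\<close> because all exponents, including
  \<open>\<alpha> - 1\<close>, are nonnegative. This is where \<open>\<alpha> \<ge> 1\<close> is used.
\<close>

lemma source_term_bound:
  fixes a b c k \<alpha> \<beta> p :: real
  assumes "1 \<le> \<alpha>" and "0 < \<beta>" and "\<alpha> + \<beta> = p" and "0 \<le> k"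
    and "\<bar>a\<bar> \<le> c" and "\<bar>b\<bar> \<le> c"
  shows "\<bar>\<bar>a\<bar> powr (\<alpha> - 2) * a * \<bar>b\<bar> powr \<beta> * soft_threshold k a\<bar>
           \<le> c powr (p - 1) * max 0 (c - k)"
proof -
  have "\<bar>\<bar>a\<bar> powr (\<alpha> - 2) * a\<bar> \<le> c powr (\<alpha> - 1)"
  proof (cases "a = 0")
    case False
    have "\<bar>\<bar>a\<bar> powr (\<alpha> - 2) * a\<bar> = \<bar>a\<bar> * \<bar>a\<bar> powr (\<alpha> - 2)" by (simp add: abs_mult)
    also have "\<dots> = \<bar>a\<bar> powr (\<alpha> - 1)" by (subst powr_mult_base) auto
    also have "\<dots> \<le> c powr (\<alpha> - 1)" using assms by (intro powr_mono2) auto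
    finally show ?thesis .
  qed simp
  moreover have "\<bar>b\<bar> powr \<beta> \<le> c powr \<beta>" using assms by (intro powr_mono2) auto
  moreover have "\<bar>soft_threshold k a\<bar> \<le> max 0 (c - k)"
    using assms by (auto simp: abs_soft_threshold)
  ultimately have "\<bar>\<bar>a\<bar> powr (\<alpha> - 2) * a\<bar> * \<bar>b\<bar> powr \<beta> * \<bar>soft_threshold k a\<bar>
      \<le> c powr (\<alpha> - 1) * c powr \<beta> * max 0 (c - k)"
    by (intro mult_mono) auto
  also have "c powr (\<alpha> - 1) * c powr \<beta> = c powr (p - 1)"
    using assms(3) by (simp flip: powr_add) (simp add: algebra_simps)
  finally show ?thesis by (simp add: abs_mult)
qed

section \<open>Boundedness of eigenpairs\<close>

text \<open>
  For levels so large that the superlevel set of \<open>m\<close> has at most half the measure of the unit ball,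
  the radius in the Faber-Krahn inequality is at most \<open>1\<close>. The powers \<open>R powr (r * p)\<close> and
  \<open>R powr (s * p)\<close> are then both dominated by the one with the smaller order, and the estimates for
  \<open>u\<close> and \<open>v\<close> add up to one for \<open>m\<close>.
\<close>

lemma eigenpair_bounded:
  fixes \<Omega> :: "'a::euclidean_space set" and u v :: "'a \<Rightarrow> real"
  assumes "open \<Omega>" and "1 < p" and "0 < r" and "0 < s" and "1 \<le> \<alpha>" and "1 \<le> \<beta>"
    and "\<alpha> + \<beta> = p" and eig: "eigenpair \<Omega> p r s \<alpha> \<beta> \<mu> u v"
  shows "\<exists>K. AE x in lebesgue. max \<bar>u x\<bar> \<bar>v x\<bar> \<le> K"
proof -
  define m where "m x = max \<bar>u x\<bar> \<bar>v x\<bar>" for x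
  define I where "I = (LINT x|lebesgue. m x powr p)"
  define J where "J k = (LINT x|lebesgue. m x powr (p - 1) * max 0 (m x - k))" for k
  define a where "a k = measure lebesgue {x. k < m x}" for k
  define \<omega> where "\<omega> = measure lborel (ball (0::'a) 1)"
  define c1 where "c1 = \<mu> * (\<alpha> / p)"
  define c2 where "c2 = \<mu> * (\<beta> / p)"
  define \<sigma> where "\<sigma> = min r s * p"
  define k0 where "k0 = max 1 (2 * I / \<omega>)"
  have u: "u \<in> frac_sobolev_zero r p \<Omega>" and v: "v \<in> frac_sobolev_zero s p \<Omega>"
    using eig by (auto simp: eigenpair_def)
  note [measurable] = frac_sobolev_zeroD(1)[OF u] frac_sobolev_zeroD(1)[OF v]
  have \<omega>: "\<omega> > 0" using content_ball_gt_0_iff[of "0::'a" 1] by (simp add: \<omega>_def)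
  have m_meas [measurable]: "m \<in> borel_measurable lebesgue" unfolding m_def by measurable
  have m: "0 \<le> m x" "\<bar>u x\<bar> \<le> m x" "\<bar>v x\<bar> \<le> m x" for x by (auto simp: m_def)
  have m_powr: "m x powr p \<le> \<bar>u x\<bar> powr p + \<bar>v x\<bar> powr p" for x
    by (auto simp: m_def max_def)
  have int_p: "integrable lebesgue (\<lambda>x. m x powr p)"
    by (rule Bochner_Integration.integrable_bound[OF
          Bochner_Integration.integrable_add[OF frac_sobolev_zeroD(2)[OF u] frac_sobolev_zeroD(2)[OF v]]])
       (use m_powr in \<open>auto intro!: AE_I2\<close>)
  have I0: "I \<ge> 0" unfolding I_def by (rule Bochner_Integration.integral_nonneg) auto
  have J0: "J k \<ge> 0" for k unfolding J_def by (rule Bochner_Integration.integral_nonneg) auto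
  have int_J: "integrable lebesgue (\<lambda>x. m x powr (p - 1) * max 0 (m x - k))" if "0 < k" for k
  proof (rule Bochner_Integration.integrable_bound[OF int_p])
    have "m x powr (p - 1) * max 0 (m x - k) \<le> m x powr p" for x
    proof -
      have "m x powr (p - 1) * max 0 (m x - k) \<le> m x powr (p - 1) * m x"
        using that m(1)[of x] by (intro mult_left_mono) auto
      also have "\<dots> = m x powr p" using m(1)[of x] by (subst mult.commute, subst powr_mult_base) auto
      finally show ?thesis .
    qed
    then show "AE x in lebesgue. norm (m x powr (p - 1) * max 0 (m x - k)) \<le> norm (m x powr p)"
      by (auto simp: abs_mult)
  qed measurable
  note level = m_meas m(1) \<open>1 < p\<close> int_p
  have superlevel: "{x. k < m x} \<in> lmeasurable" if "0 < k" for k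
  proof -
    have "{x \<in> space lebesgue. k < m x} \<in> sets lebesgue" by measurable
    then show ?thesis
      using finite_superlevel[OF level that] by (simp add: fmeasurable_def)
  qed
  have caccioppoli: "(LINT x|lebesgue. max 0 (m x - k) powr p)
      \<le> 2 / \<omega> * (2 / \<omega>) powr (\<sigma> / real DIM('a)) * (\<bar>c1\<bar> + \<bar>c2\<bar>) * a k powr (\<sigma> / real DIM('a)) * J k"
    if k: "k \<ge> k0" for k
  proof (cases "a k = 0")
    case True
    have "0 < k" using k by (simp add: k0_def)
    then have "{x. k < m x} \<in> null_sets lebesgue"
      using True superlevel[of k] by (auto simp: a_def fmeasurable_def measure_def enn2real_eq_0_iff)
    then have "AE x in lebesgue. max 0 (m x - k) powr p = 0"
      by (rule AE_I') auto
    then have "(LINT x|lebesgue. max 0 (m x - k) powr p) = 0" by (rule integral_eq_zero_AE)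
    then show ?thesis using True by simp
  next
    case False
    then have apos: "a k > 0" by (simp add: a_def zero_less_measure_iff)
    have kpos: "k > 0" "k \<ge> 1" using k by (auto simp: k0_def)
    \<comment> \<open>The ball of this radius has twice the measure of the superlevel set.\<close>
    define R where "R = (2 / \<omega> * a k) powr (1 / real DIM('a))"
    have R: "R > 0" using \<omega> apos by (auto simp: R_def)
    have "a k \<le> I / k powr p"
      using measure_superlevel_le_powr[OF level kpos(1)] by (simp add: a_def I_def)
    also have "\<dots> \<le> I / k powr 1"
      using kpos I0 \<open>1 < p\<close> by (intro divide_left_mono powr_mono mult_pos_pos) auto
    also have "\<dots> \<le> \<omega> / 2" using k \<omega> kpos by (simp add: k0_def field_simps)
    finally have "2 / \<omega> * a k \<le> 1" using \<omega> by (simp add: field_simps)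
    then have R1: "R \<le> 1" unfolding R_def using \<omega> apos by (intro powr_le1) auto
    have "R ^ DIM('a) = 2 / \<omega> * a k"
      using \<omega> apos by (simp add: R_def powr_powr flip: powr_realpow)
    then have "measure lborel (ball (0::'a) R) = 2 * a k"
      using R \<omega> by (simp add: content_ball_conv_unit_ball[of R] \<omega>_def)
    then have small: "measure lebesgue {x. k < m x} \<le> measure lborel (ball (0::'a) R) / 2"
      by (simp add: a_def)
    have R\<sigma>: "R powr \<sigma> = (2 / \<omega>) powr (\<sigma> / real DIM('a)) * a k powr (\<sigma> / real DIM('a))"
      by (simp add: R_def powr_powr flip: powr_mult)
    have tu: "(\<lambda>x. soft_threshold k (u x)) \<in> frac_sobolev_zero r p \<Omega>"
      and tv: "(\<lambda>x. soft_threshold k (v x)) \<in> frac_sobolev_zero s p \<Omega>"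
      using soft_threshold_in_frac_sobolev_zero[OF u \<open>open \<Omega>\<close>, of k]
        soft_threshold_in_frac_sobolev_zero[OF v \<open>open \<Omega>\<close>, of k] kpos \<open>1 < p\<close> by auto
    have "(LINT x|lebesgue. max 0 (\<bar>u x\<bar> - k) powr p) \<le> 2 / \<omega> * R powr (r * p) * (\<bar>c1\<bar> * J k)"
      unfolding \<omega>_def J_def
    proof (rule soft_threshold_energy_estimate[OF u \<open>open \<Omega>\<close> kpos(1) \<open>1 < p\<close> \<open>0 < r\<close> _ _
          int_J[OF kpos(1)] m(2) superlevel[OF kpos(1)] R small])
      show "frac_plap_form r p u (\<lambda>x. soft_threshold k (u x)) = c1 * (LINT x|lebesgue_on \<Omega>.
             \<bar>u x\<bar> powr (\<alpha> - 2) * u x * \<bar>v x\<bar> powr \<beta> * soft_threshold k (u x))"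
        using eig tu tv unfolding eigenpair_def c1_def by blast
    qed (use assms kpos m in \<open>auto intro!: source_term_bound\<close>)
    also have "\<dots> \<le> 2 / \<omega> * R powr \<sigma> * (\<bar>c1\<bar> * J k)"
      using R R1 \<omega> J0[of k] \<open>1 < p\<close>
      by (intro mult_right_mono mult_left_mono powr_mono') (auto simp: \<sigma>_def)
    finally have eu: "(LINT x|lebesgue. max 0 (\<bar>u x\<bar> - k) powr p) \<le> 2 / \<omega> * R powr \<sigma> * (\<bar>c1\<bar> * J k)" .
    have "(LINT x|lebesgue. max 0 (\<bar>v x\<bar> - k) powr p) \<le> 2 / \<omega> * R powr (s * p) * (\<bar>c2\<bar> * J k)"
      unfolding \<omega>_def J_def
    proof (rule soft_threshold_energy_estimate[OF v \<open>open \<Omega>\<close> kpos(1) \<open>1 < p\<close> \<open>0 < s\<close> _ _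
          int_J[OF kpos(1)] m(3) superlevel[OF kpos(1)] R small])
      have "frac_plap_form s p v (\<lambda>x. soft_threshold k (v x)) = c2 * (LINT x|lebesgue_on \<Omega>.
             \<bar>u x\<bar> powr \<alpha> * \<bar>v x\<bar> powr (\<beta> - 2) * v x * soft_threshold k (v x))"
        using eig tu tv unfolding eigenpair_def c2_def by blast
      then show "frac_plap_form s p v (\<lambda>x. soft_threshold k (v x)) = c2 * (LINT x|lebesgue_on \<Omega>.
             \<bar>v x\<bar> powr (\<beta> - 2) * v x * \<bar>u x\<bar> powr \<alpha> * soft_threshold k (v x))"
        by (simp only: mult_ac)
    qed (use assms kpos m in \<open>auto intro!: source_term_bound\<close>)
    also have "\<dots> \<le> 2 / \<omega> * R powr \<sigma> * (\<bar>c2\<bar> * J k)"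
      using R R1 \<omega> J0[of k] \<open>1 < p\<close>
      by (intro mult_right_mono mult_left_mono powr_mono') (auto simp: \<sigma>_def)
    finally have ev: "(LINT x|lebesgue. max 0 (\<bar>v x\<bar> - k) powr p) \<le> 2 / \<omega> * R powr \<sigma> * (\<bar>c2\<bar> * J k)" .
    have int_u: "integrable lebesgue (\<lambda>x. max 0 (\<bar>u x\<bar> - k) powr p)"
      using frac_sobolev_zeroD(2)[OF tu] kpos by (simp add: abs_soft_threshold)
    have int_v: "integrable lebesgue (\<lambda>x. max 0 (\<bar>v x\<bar> - k) powr p)"
      using frac_sobolev_zeroD(2)[OF tv] kpos by (simp add: abs_soft_threshold)
    have "(LINT x|lebesgue. max 0 (m x - k) powr p)
        \<le> (LINT x|lebesgue. max 0 (\<bar>u x\<bar> - k) powr p + max 0 (\<bar>v x\<bar> - k) powr p)"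
      using int_u int_v by (intro integral_mono' Bochner_Integration.integrable_add) (auto simp: m_def max_def)
    also have "\<dots> = (LINT x|lebesgue. max 0 (\<bar>u x\<bar> - k) powr p) + (LINT x|lebesgue. max 0 (\<bar>v x\<bar> - k) powr p)"
      using int_u int_v by simp
    also have "\<dots> \<le> 2 / \<omega> * R powr \<sigma> * (\<bar>c1\<bar> * J k) + 2 / \<omega> * R powr \<sigma> * (\<bar>c2\<bar> * J k)"
      by (intro add_mono eu ev)
    also have "\<dots> = 2 / \<omega> * (2 / \<omega>) powr (\<sigma> / real DIM('a)) * (\<bar>c1\<bar> + \<bar>c2\<bar>) * a k powr (\<sigma> / real DIM('a)) * J k"
      unfolding R\<sigma> by (simp only: distrib_left distrib_right mult_ac)
    finally show ?thesis .
  qed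
  have "\<exists>K. AE x in lebesgue. m x \<le> K"
  proof (rule bounded_of_caccioppoli[OF level])
    show "0 \<le> 2 / \<omega> * (2 / \<omega>) powr (\<sigma> / real DIM('a)) * (\<bar>c1\<bar> + \<bar>c2\<bar>)" using \<omega> by simp
    show "0 < \<sigma> / real DIM('a)" using assms by (auto simp: \<sigma>_def)
    show "0 < k0" by (simp add: k0_def)
  qed (use caccioppoli in \<open>simp add: a_def J_def\<close>)
  then show ?thesis by (simp add: m_def)
qed

theorem lemma3p3:
  fixes \<Omega> :: "'a::euclidean_space set"
    and p r s \<alpha> \<beta> :: real
    and u v :: "'a \<Rightarrow> real"
  assumes "bounded_smooth_domain \<Omega>"
    and "p > 1"
    and "0 < r" and "r < 1" and "0 < s" and "s < 1"
    and "0 < \<alpha>" and "\<alpha> < p" and "0 < \<beta>" and "\<beta> < p"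
    and "\<alpha> + \<beta> = p"
    and "min \<alpha> \<beta> \<ge> 1"
    and "eigenpair \<Omega> p r s \<alpha> \<beta> (lambda1 \<Omega> p r s \<alpha> \<beta>) u v"
  shows "u \<in> L_infinity \<and> v \<in> L_infinity"
proof -
  have "open \<Omega>" using assms(1) by (simp add: bounded_smooth_domain_def)
  then obtain K where K: "AE x in lebesgue. max \<bar>u x\<bar> \<bar>v x\<bar> \<le> K"
    using eigenpair_bounded[of \<Omega> p r s \<alpha> \<beta> "lambda1 \<Omega> p r s \<alpha> \<beta>" u v] assms by auto
  have "u \<in> borel_measurable lebesgue" "v \<in> borel_measurable lebesgue"
    using assms(13) by (auto simp: eigenpair_def dest: frac_sobolev_zeroD(1))
  moreover have "AE x in lebesgue. \<bar>u x\<bar> \<le> K" "AE x in lebesgue. \<bar>v x\<bar> \<le> K"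
    using K by (eventually_elim, simp)+
  ultimately show ?thesis unfolding L_infinity_def by blast
qed

end
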